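(* Let $(M,\lambda_i(x,y),F(x,y))$ be an FP-space. Then the GAP-metric and the Finsler metric coincide: on $\tau M$, $$g_{\mu\nu}=\sum_{i=1}^n\lambda_{i\mu}(x,y)\,\lambda_{i\nu}(x,y)=\tfrac12\,\dot\partial_\mu\dot\partial_\nu F^2 .$$
   Context: $M$ is a smooth $n$-dimensional manifold, $\pi:TM\to M$ its tangent bundle, $\tau M:=TM\setminus\{0\}$, $(x^\mu,y^\mu)$ the induced coordinates on $TM$, $\dot\partial_\mu:=\partial/\partial y^\mu$. Repeated Greek indices are summed. The pullback bundle $\pi^{-1}(TM)$ has fibre $T_xM$ over $(x,y)$; its sections have components $X^\alpha(x,y)$ transforming like the components of a vector on $M$. An FP-space (Finslerized Parallelizable space) $(M,\lambda_i,F)$ consists of $M$ together with $n$ global sections $\lambda_i$ ($i=1,\dots,n$) of $\pi^{-1}(TM)$, smooth over $\tau M$ and linearly independent at each point, with components $\lambda_i^\alpha$ and inverse matrix $(\lambda_{i\alpha})$ ($\sum_i\lambda_i^\alpha\lambda_{i\beta}=\delta^\alpha_\beta$, $\lambda_i^\alpha\lambda_{j\alpha}=\delta_{ij}$), such that, with $g_{\mu\nu}:=\sum_i\lambda_{i\mu}\lambda_{i\nu}$ (the GAP-metric): (1) $\dot\partial_\alpha g_{\mu\nu}$ is totally symmetric in $\alpha,\mu,\nu$; (2) each $\lambda_i(x,y)$ is positively homogeneous of degree zero in $y$; and $F(x,y):=\sqrt{g_{\mu\nu}(x,y)y^\mu y^\nu}$ (with $F(x,0)=0$). The Finsler metric of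 $F$ is $\frac12\dot\partial_\mu\dot\partial_\nu F^2$. *)

theory Defs
  imports "HOL-Analysis.Analysis"
begin

section \<open>Smooth maps on open sets\<close>

text \<open>Class \<open>C\<^sup>k\<close>, meant for open \<open>S\<close> in a finite-dimensional space, where asking that every
  directional derivative be of class \<open>C\<^sup>k\<close> is the same as asking it of the derivative.\<close>

primrec Ck_on :: "nat \<Rightarrow> 'a::euclidean_space set \<Rightarrow> ('a \<Rightarrow> 'b::euclidean_space) \<Rightarrow> bool" where
  "Ck_on 0 S f \<longleftrightarrow> continuous_on S f"
| "Ck_on (Suc k) S f \<longleftrightarrow>
     (\<forall>x\<in>S. f differentiable (at x)) \<and> (\<forall>v. Ck_on k S (\<lambda>x. frechet_derivative f (at x) v))"

definition smooth_on :: "'a::euclidean_space set \<Rightarrow> ('a \<Rightarrow> 'b::euclidean_space) \<Rightarrow> bool" where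
  "smooth_on S f \<longleftrightarrow> (\<forall>k. Ck_on k S f)"


section \<open>Smooth manifolds\<close>

text \<open>A chart is a pair \<open>(U, \<phi>)\<close>. The values of \<open>\<phi>\<close> outside \<open>U\<close> are irrelevant; they are never
  used below.\<close>

type_synonym ('m, 'n) chart = "'m set \<times> ('m \<Rightarrow> real ^ 'n)"

definition is_chart :: "'m topology \<Rightarrow> ('m, 'n::finite) chart \<Rightarrow> bool" where
  "is_chart M c \<longleftrightarrow>
     openin M (fst c) \<and> open (snd c ` fst c) \<and>
     homeomorphic_map (subtopology M (fst c)) (top_of_set (snd c ` fst c)) (snd c)"

definition transition :: "('m, 'n::finite) chart \<Rightarrow> ('m, 'n) chart \<Rightarrow> real ^ 'n \<Rightarrow> real ^ 'n" where
  "transition c d = snd d \<circ> inv_into (fst c) (snd c)"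

definition smooth_compatible :: "('m, 'n::finite) chart \<Rightarrow> ('m, 'n) chart \<Rightarrow> bool" where
  "smooth_compatible c d \<longleftrightarrow>
     smooth_on (snd c ` (fst c \<inter> fst d)) (transition c d) \<and>
     smooth_on (snd d ` (fst c \<inter> fst d)) (transition d c)"

text \<open>The dimension of the manifold is \<open>CARD('n)\<close>; \<open>A\<close> is its smooth structure, i.e. the set of
  all its smooth charts (a maximal atlas).\<close>

locale smooth_manifold =
  fixes M :: "'m topology"
    and A :: "('m, 'n::finite) chart set"
  assumes hausdorff: "Hausdorff_space M"
    and second_countable: "second_countable M"
    and charts: "\<And>c. c \<in> A \<Longrightarrow> is_chart M c"
    and cover: "(\<Union>c\<in>A. fst c) = topspace M"
    and compatible: "\<And>c d. c \<in> A \<Longrightarrow> d \<in> A \<Longrightarrow> smooth_compatible c d"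
    and maximal: "\<And>e. is_chart M e \<Longrightarrow> (\<And>c. c \<in> A \<Longrightarrow> smooth_compatible c e) \<Longrightarrow> e \<in> A"


section \<open>The tangent bundle and its induced coordinates\<close>

text \<open>A tangent vector at \<open>p\<close> is the family of its component vectors in all charts around \<open>p\<close>,
  related by the Jacobians of the coordinate changes. It is extended by \<open>0\<close> to the remaining
  (irrelevant) pairs, so that equality of tangent vectors is equality of functions.\<close>

type_synonym ('m, 'n) tvec = "('m, 'n) chart \<Rightarrow> real ^ 'n"
type_synonym ('m, 'n) tpoint = "'m \<times> ('m, 'n) tvec"

definition tangent_space :: "('m, 'n::finite) chart set \<Rightarrow> 'm \<Rightarrow> ('m, 'n) tvec set" where
  "tangent_space A p = {v.
     (\<forall>c. \<not> (c \<in> A \<and> p \<in> fst c) \<longrightarrow> v c = 0) \<and>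
     (\<forall>c\<in>A. \<forall>d\<in>A. p \<in> fst c \<inter> fst d \<longrightarrow>
        v d = frechet_derivative (transition c d) (at (snd c p)) (v c))}"

definition tzero :: "('m, 'n::finite) tvec" where
  "tzero = (\<lambda>c. 0)"

definition tscale :: "real \<Rightarrow> ('m, 'n::finite) tvec \<Rightarrow> ('m, 'n) tvec" where
  "tscale a v = (\<lambda>c. a *\<^sub>R v c)"

definition tsum :: "('i::finite \<Rightarrow> ('m, 'n::finite) tvec) \<Rightarrow> ('m, 'n) tvec" where
  "tsum v = (\<lambda>c. \<Sum>i\<in>UNIV. v i c)"

definition tangent_bundle :: "'m topology \<Rightarrow> ('m, 'n::finite) chart set \<Rightarrow> ('m, 'n) tpoint set" where
  "tangent_bundle M A = (SIGMA p:topspace M. tangent_space A p)"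

definition slit_bundle :: "'m topology \<Rightarrow> ('m, 'n::finite) chart set \<Rightarrow> ('m, 'n) tpoint set" where
  "slit_bundle M A = {(x, y) \<in> tangent_bundle M A. y \<noteq> tzero}"

text \<open>The tangent vector at \<open>p\<close> whose components in the chart \<open>c\<close> are \<open>b\<close>.\<close>

definition tvec_of :: "('m, 'n::finite) chart set \<Rightarrow> ('m, 'n) chart \<Rightarrow> 'm \<Rightarrow> real ^ 'n \<Rightarrow> ('m, 'n) tvec" where
  "tvec_of A c p b = (\<lambda>d. if d \<in> A \<and> p \<in> fst d
     then frechet_derivative (transition c d) (at (snd c p)) b else 0)"

text \<open>The point of the tangent bundle with induced coordinates \<open>(a, b)\<close>, where \<open>a\<close> stands for
  \<open>(x\<^sup>\<mu>)\<close> and \<open>b\<close> for \<open>(y\<^sup>\<mu>)\<close>. The coordinates of \<open>(x, y)\<close> are \<open>(snd c x, y c)\<close>.\<close>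

definition tpoint_of :: "('m, 'n::finite) chart set \<Rightarrow> ('m, 'n) chart \<Rightarrow> (real ^ 'n) \<times> (real ^ 'n) \<Rightarrow> ('m, 'n) tpoint" where
  "tpoint_of A c = (\<lambda>(a, b). let p = inv_into (fst c) (snd c) a in (p, tvec_of A c p b))"

text \<open>\<open>\<partial>/\<partial>y\<^sup>\<mu>\<close> in the coordinates induced by \<open>c\<close>, for functions on (part of) the tangent bundle.\<close>

definition vpartial :: "('m, 'n::finite) chart set \<Rightarrow> ('m, 'n) chart \<Rightarrow> 'n
    \<Rightarrow> (('m, 'n) tpoint \<Rightarrow> real) \<Rightarrow> ('m, 'n) tpoint \<Rightarrow> real" where
  "vpartial A c \<mu> f = (\<lambda>(x, y). deriv (\<lambda>t. f (tpoint_of A c (snd c x, y c + t *\<^sub>R axis \<mu> 1))) 0)"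


section \<open>Sections of the pullback bundle\<close>

definition pullback_section :: "'m topology \<Rightarrow> ('m, 'n::finite) chart set
    \<Rightarrow> (('m, 'n) tpoint \<Rightarrow> ('m, 'n) tvec) \<Rightarrow> bool" where
  "pullback_section M A X \<longleftrightarrow> (\<forall>(x, y) \<in> tangent_bundle M A. X (x, y) \<in> tangent_space A x)"

definition smooth_section_on_slit :: "('m, 'n::finite) chart set
    \<Rightarrow> (('m, 'n) tpoint \<Rightarrow> ('m, 'n) tvec) \<Rightarrow> bool" where
  "smooth_section_on_slit A X \<longleftrightarrow>
     (\<forall>c\<in>A. smooth_on ((snd c ` fst c) \<times> (UNIV - {0})) (\<lambda>q. X (tpoint_of A c q) c))"


section \<open>FP-spaces\<close>

text \<open>\<open>frame_matrix lam c p $ i $ \<alpha>\<close> is \<open>\<lambda>\<^sub>i\<^sup>\<alpha>(p)\<close> in the chart \<open>c\<close>. The matrix \<open>(\<lambda>\<^sub>i\<^sub>\<alpha>)\<close> in the same index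
  order is the transpose of the inverse: \<open>\<Sum>\<^sub>\<alpha> \<lambda>\<^sub>i\<^sup>\<alpha> \<lambda>\<^sub>j\<^sub>\<alpha> = \<delta>\<^sub>i\<^sub>j\<close> and \<open>\<Sum>\<^sub>i \<lambda>\<^sub>i\<^sup>\<alpha> \<lambda>\<^sub>i\<^sub>\<beta> = \<delta>\<^sup>\<alpha>\<^sub>\<beta>\<close>.\<close>

definition frame_matrix :: "('n \<Rightarrow> ('m, 'n::finite) tpoint \<Rightarrow> ('m, 'n) tvec)
    \<Rightarrow> ('m, 'n) chart \<Rightarrow> ('m, 'n) tpoint \<Rightarrow> real ^ 'n ^ 'n" where
  "frame_matrix lam c p = (\<chi> i. lam i p c)"

definition coframe :: "('n \<Rightarrow> ('m, 'n::finite) tpoint \<Rightarrow> ('m, 'n) tvec)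
    \<Rightarrow> ('m, 'n) chart \<Rightarrow> 'n \<Rightarrow> 'n \<Rightarrow> ('m, 'n) tpoint \<Rightarrow> real" where
  "coframe lam c i \<alpha> p = matrix_inv (frame_matrix lam c p) $ \<alpha> $ i"

definition gap_metric :: "('n \<Rightarrow> ('m, 'n::finite) tpoint \<Rightarrow> ('m, 'n) tvec)
    \<Rightarrow> ('m, 'n) chart \<Rightarrow> 'n \<Rightarrow> 'n \<Rightarrow> ('m, 'n) tpoint \<Rightarrow> real" where
  "gap_metric lam c \<mu> \<nu> p = (\<Sum>i\<in>UNIV. coframe lam c i \<mu> p * coframe lam c i \<nu> p)"

definition finsler_metric :: "('m, 'n::finite) chart set \<Rightarrow> (('m, 'n) tpoint \<Rightarrow> real)
    \<Rightarrow> ('m, 'n) chart \<Rightarrow> 'n \<Rightarrow> 'n \<Rightarrow> ('m, 'n) tpoint \<Rightarrow> real" where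
  "finsler_metric A F c \<mu> \<nu> p = 1 / 2 * vpartial A c \<mu> (vpartial A c \<nu> (\<lambda>q. (F q)\<^sup>2)) p"

text \<open>Since \<open>g\<close> is symmetric in \<open>\<mu>, \<nu>\<close> by definition, total symmetry of \<open>\<partial>g\<^sub>\<mu>\<^sub>\<nu>/\<partial>y\<^sup>\<alpha>\<close> amounts to
  invariance under exchange of \<open>\<alpha>\<close> and \<open>\<mu>\<close>. The sections live on the whole tangent bundle, and
  their independence is required there; on the zero section this is no restriction, as smoothness
  is only asked on the slit bundle.\<close>

locale fp_space = smooth_manifold M A
  for M :: "'m topology"
    and A :: "('m, 'n::finite) chart set" +
  fixes lam :: "'n \<Rightarrow> ('m, 'n) tpoint \<Rightarrow> ('m, 'n) tvec"
    and F :: "('m, 'n) tpoint \<Rightarrow> real"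
  assumes sections: "\<And>i. pullback_section M A (lam i)"
    and smooth: "\<And>i. smooth_section_on_slit A (lam i)"
    and independent: "\<And>p a. p \<in> tangent_bundle M A \<Longrightarrow>
      tsum (\<lambda>i. tscale (a i) (lam i p)) = tzero \<Longrightarrow> (\<forall>i. a i = 0)"
    and symmetric: "\<And>c x y \<alpha> \<mu> \<nu>. c \<in> A \<Longrightarrow> x \<in> fst c \<Longrightarrow> (x, y) \<in> slit_bundle M A \<Longrightarrow>
      vpartial A c \<alpha> (gap_metric lam c \<mu> \<nu>) (x, y) = vpartial A c \<mu> (gap_metric lam c \<alpha> \<nu>) (x, y)"
    and homogeneous: "\<And>i x y a. (x, y) \<in> tangent_bundle M A \<Longrightarrow> 0 < a \<Longrightarrow>
      lam i (x, tscale a y) = lam i (x, y)"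
    and F_slit: "\<And>c x y. c \<in> A \<Longrightarrow> x \<in> fst c \<Longrightarrow> (x, y) \<in> slit_bundle M A \<Longrightarrow>
      F (x, y) = sqrt (\<Sum>\<mu>\<in>UNIV. \<Sum>\<nu>\<in>UNIV. gap_metric lam c \<mu> \<nu> (x, y) * y c $ \<mu> * y c $ \<nu>)"
    and F_zero: "\<And>x. x \<in> topspace M \<Longrightarrow> F (x, tzero) = 0"

end

theory Submission
  imports Defs
begin

text \<open>Everything takes place in a single tangent space. For fixed \<open>x\<close> the GAP-metric is a family
  \<open>g\<^sub>\<mu>\<^sub>\<nu>\<close> of functions of \<open>y \<noteq> 0\<close>, homogeneous of degree zero, and \<open>F\<^sup>2 = g\<^sub>\<alpha>\<^sub>\<beta> y\<^sup>\<alpha> y\<^sup>\<beta>\<close>. Total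
  symmetry of \<open>\<partial>\<^sub>\<alpha> g\<^sub>\<mu>\<^sub>\<nu>\<close> allows the index of differentiation to be exchanged with any other, so
  contracting \<^emph>\<open>any\<close> of the three indices with \<open>y\<close> gives the same as contracting the index of
  differentiation, which is \<open>0\<close> by Euler's relation
  (\<open>cartan_symmetric.contraction_vanishes\<close>). In the product rule for \<open>F\<^sup>2\<close> all terms that differentiate
  \<open>g\<close> are such contractions, hence
  \[ \partial_\nu F^2 = 2 g_{\nu\beta} y^\beta, \qquad
     \partial_\mu \partial_\nu F^2 = 2 g_{\mu\nu}. \]
  This is \<open>cartan_symmetric.half_hessian_energy\<close>, a statement about functions on \<open>\<real>\<^sup>n \<setminus> {0}\<close>.

  The remaining work is to check that the GAP-metric in fibre coordinates is such a family
  (\<open>fp_space.cartan_symmetric_gap_metric\<close>). Euler's relation and the product rule need \<open>g\<close> to be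
  differentiable: its entries are sums of products of entries of the inverse of the frame matrix,
  which by Cramer's rule are quotients of determinants. The determinant of the frame
  matrix has no zero because a linear relation between the components of tangent vectors in one
  chart is carried to every other chart by the Jacobians.\<close>

section \<open>Partial derivatives in a coordinate space\<close>

definition partial_deriv :: "'n \<Rightarrow> (real ^ 'n::finite \<Rightarrow> real) \<Rightarrow> real ^ 'n \<Rightarrow> real" where
  "partial_deriv \<mu> f b = deriv (\<lambda>t. f (b + t *\<^sub>R axis \<mu> 1)) 0"

lemma has_real_derivative_along_line:
  fixes f :: "'a::real_normed_vector \<Rightarrow> real"
  assumes "f differentiable (at b)"
  shows "((\<lambda>t. f (b + t *\<^sub>R v)) has_real_derivative frechet_derivative f (at b) v) (at 0)"
proof -
  have f': "(f has_derivative frechet_derivative f (at b)) (at (b + 0 *\<^sub>R v))"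
    using assms by (simp add: frechet_derivative_works)
  have line: "((\<lambda>t::real. b + t *\<^sub>R v) has_derivative (\<lambda>t. t *\<^sub>R v)) (at 0)"
    by (auto intro!: derivative_eq_intros)
  have "((\<lambda>t. f (b + t *\<^sub>R v)) has_derivative (\<lambda>t. frechet_derivative f (at b) (t *\<^sub>R v))) (at 0)"
    using has_derivative_compose[OF line f'] .
  then show ?thesis
    by (simp add: has_field_derivative_def linear_scale[OF linear_frechet_derivative[OF assms]]
        mult_commute_abs)
qed

lemma has_partial_deriv:
  assumes "f differentiable (at b)"
  shows "((\<lambda>t. f (b + t *\<^sub>R axis \<mu> 1)) has_real_derivative partial_deriv \<mu> f b) (at 0)"
  unfolding partial_deriv_def
  using has_real_derivative_along_line[OF assms] DERIV_imp_deriv by metis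

lemma partial_deriv_eqI:
  assumes "((\<lambda>t. f (b + t *\<^sub>R axis \<mu> 1)) has_real_derivative D) (at 0)"
  shows "partial_deriv \<mu> f b = D"
  using assms unfolding partial_deriv_def by (rule DERIV_imp_deriv)

text \<open>Two functions are compared near \<open>b\<close> only, since the formulas for the derivatives of \<open>F\<^sup>2\<close>
  hold away from the zero vector.\<close>

lemma partial_deriv_cong_ev:
  assumes "\<forall>\<^sub>F b' in nhds b. f b' = g b'"
  shows "partial_deriv \<mu> f b = partial_deriv \<mu> g b"
  unfolding partial_deriv_def
proof (rule deriv_cong_ev)
  have "((\<lambda>t::real. b + t *\<^sub>R axis \<mu> 1) \<longlongrightarrow> b + 0 *\<^sub>R axis \<mu> 1) (nhds 0)"
    by (intro tendsto_intros filterlim_ident)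
  then have "filterlim (\<lambda>t::real. b + t *\<^sub>R axis \<mu> 1) (nhds b) (nhds 0)"
    by simp
  with assms show "\<forall>\<^sub>F t in nhds 0. f (b + t *\<^sub>R axis \<mu> 1) = g (b + t *\<^sub>R axis \<mu> 1)"
    by (rule eventually_compose_filterlim)
qed simp

lemma frechet_derivative_eq_sum_partial_deriv:
  assumes "f differentiable (at b)"
  shows "frechet_derivative f (at b) v = (\<Sum>\<mu>\<in>UNIV. partial_deriv \<mu> f b * v $ \<mu>)"
proof -
  have lin: "linear (frechet_derivative f (at b))"
    by (rule linear_frechet_derivative[OF assms])
  have "frechet_derivative f (at b) v = frechet_derivative f (at b) (\<Sum>\<mu>\<in>UNIV. v $ \<mu> *s axis \<mu> 1)"
    by (simp add: basis_expansion)
  also have "\<dots> = (\<Sum>\<mu>\<in>UNIV. v $ \<mu> * frechet_derivative f (at b) (axis \<mu> 1))"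
    by (simp add: linear_sum[OF lin] linear_scale[OF lin] scalar_mult_eq_scaleR)
  also have "\<dots> = (\<Sum>\<mu>\<in>UNIV. partial_deriv \<mu> f b * v $ \<mu>)"
    by (simp add: partial_deriv_eqI[OF has_real_derivative_along_line[OF assms]] mult.commute)
  finally show ?thesis .
qed

text \<open>Euler's relation in degree zero: the left-hand side is the derivative of \<open>f\<close> along the ray
  through \<open>b\<close>, on which \<open>f\<close> is constant.\<close>

lemma euler_degree_zero:
  assumes diff: "f differentiable (at b)"
    and hom: "\<And>s. 0 < s \<Longrightarrow> f (s *\<^sub>R b) = f b"
  shows "(\<Sum>\<mu>\<in>UNIV. partial_deriv \<mu> f b * b $ \<mu>) = 0"
proof -
  \<comment> \<open>The point \<open>b + t b\<close> stays on the open ray as long as \<open>t > -1\<close>.\<close>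
  have "((\<lambda>t::real. f b) has_real_derivative frechet_derivative f (at b) b) (at 0)"
  proof (rule has_field_derivative_transform_within_open
      [OF has_real_derivative_along_line[OF diff, of b], of "{-1<..}"])
    fix t :: real assume "t \<in> {-1<..}"
    then show "f (b + t *\<^sub>R b) = f b"
      using hom[of "1 + t"] by (simp add: scaleR_add_left)
  qed auto
  then have "frechet_derivative f (at b) b = 0"
    using DERIV_unique DERIV_const by blast
  then show ?thesis
    using frechet_derivative_eq_sum_partial_deriv[OF diff, of b] by simp
qed

section \<open>Symmetric degree-zero coefficients\<close>

text \<open>The properties of a GAP-metric restricted to one tangent space. In Finsler geometry the
  tensor \<open>\<partial>\<^sub>\<alpha> G\<^sub>\<mu>\<^sub>\<nu>\<close>, up to a factor, is the Cartan tensor, and its total symmetry characterises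
  the metrics that come from a Finsler function. Exchange of \<open>\<alpha>\<close> and \<open>\<mu>\<close> together with symmetry of
  \<open>G\<close> generates all permutations of the three indices.\<close>

locale cartan_symmetric =
  fixes G :: "'n::finite \<Rightarrow> 'n \<Rightarrow> real ^ 'n \<Rightarrow> real"
  assumes differentiable: "\<And>\<mu> \<nu> b. b \<noteq> 0 \<Longrightarrow> G \<mu> \<nu> differentiable (at b)"
    and commute: "\<And>\<mu> \<nu> b. G \<mu> \<nu> b = G \<nu> \<mu> b"
    and homogeneous: "\<And>\<mu> \<nu> b s. 0 < s \<Longrightarrow> G \<mu> \<nu> (s *\<^sub>R b) = G \<mu> \<nu> b"
    and symmetric: "\<And>\<alpha> \<mu> \<nu> b. b \<noteq> 0 \<Longrightarrow> partial_deriv \<alpha> (G \<mu> \<nu>) b = partial_deriv \<mu> (G \<alpha> \<nu>) b"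
begin

definition energy :: "real ^ 'n \<Rightarrow> real" where
  "energy b = (\<Sum>\<mu>\<in>UNIV. \<Sum>\<nu>\<in>UNIV. G \<mu> \<nu> b * b $ \<mu> * b $ \<nu>)"

text \<open>Symmetry turns the contraction with a metric index into a contraction with the index of
  differentiation, to which Euler's relation applies.\<close>

lemma contraction_vanishes:
  assumes "b \<noteq> 0"
  shows "(\<Sum>\<alpha>\<in>UNIV. partial_deriv \<mu> (G \<alpha> \<nu>) b * b $ \<alpha>) = 0"
  using euler_degree_zero[OF differentiable[OF assms, of \<mu> \<nu>]] homogeneous
  by (simp add: symmetric[OF assms, of \<mu>])

text \<open>The product rule gives three double sums. The one with \<open>\<partial>\<^sub>\<nu> G\<^sub>\<alpha>\<^sub>\<beta> y\<^sup>\<alpha> y\<^sup>\<beta>\<close> vanishes, and the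
  other two agree because \<open>G\<close> is symmetric.\<close>

lemma partial_deriv_energy:
  assumes "b \<noteq> 0"
  shows "partial_deriv \<nu> energy b = 2 * (\<Sum>\<beta>\<in>UNIV. G \<nu> \<beta> b * b $ \<beta>)"
proof (rule partial_deriv_eqI)
  note D = has_partial_deriv[OF differentiable[OF assms], of _ _ \<nu>]
  let ?D = "\<Sum>\<alpha>\<in>UNIV. \<Sum>\<beta>\<in>UNIV. partial_deriv \<nu> (G \<alpha> \<beta>) b * b $ \<alpha> * b $ \<beta>
      + G \<alpha> \<beta> b * axis \<nu> 1 $ \<alpha> * b $ \<beta> + G \<alpha> \<beta> b * b $ \<alpha> * axis \<nu> 1 $ \<beta>"
  have "((\<lambda>t. energy (b + t *\<^sub>R axis \<nu> 1)) has_real_derivative ?D) (at 0)"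
    unfolding energy_def vector_add_component vector_scaleR_component
    by (rule derivative_eq_intros D refl | simp add: algebra_simps)+
  moreover have "(\<Sum>\<alpha>\<in>UNIV. \<Sum>\<beta>\<in>UNIV. partial_deriv \<nu> (G \<alpha> \<beta>) b * b $ \<alpha> * b $ \<beta>) = 0"
    by (subst sum.swap) (simp add: contraction_vanishes[OF assms] flip: sum_distrib_right)
  moreover have "(\<Sum>\<alpha>\<in>UNIV. \<Sum>\<beta>\<in>UNIV. G \<alpha> \<beta> b * axis \<nu> 1 $ \<alpha> * b $ \<beta>) = (\<Sum>\<beta>\<in>UNIV. G \<nu> \<beta> b * b $ \<beta>)"
    by (subst sum.swap) (simp add: axis_def if_distrib if_distribR sum.delta cong: if_cong)
  moreover have "(\<Sum>\<alpha>\<in>UNIV. \<Sum>\<beta>\<in>UNIV. G \<alpha> \<beta> b * b $ \<alpha> * axis \<nu> 1 $ \<beta>) = (\<Sum>\<beta>\<in>UNIV. G \<nu> \<beta> b * b $ \<beta>)"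
    by (simp add: axis_def if_distrib sum.delta commute[of _ \<nu>] cong: if_cong)
  ultimately show "((\<lambda>t. energy (b + t *\<^sub>R axis \<nu> 1)) has_real_derivative
      2 * (\<Sum>\<beta>\<in>UNIV. G \<nu> \<beta> b * b $ \<beta>)) (at 0)"
    by (simp add: sum.distrib)
qed

text \<open>Differentiating \<open>2 G\<^sub>\<nu>\<^sub>\<beta> y\<^sup>\<beta>\<close> once more, the term with the derivative of \<open>G\<close> vanishes for the
  same reason.\<close>

theorem half_hessian_energy:
  assumes "b \<noteq> 0"
  shows "partial_deriv \<mu> (partial_deriv \<nu> energy) b / 2 = G \<mu> \<nu> b"
proof -
  have "\<forall>\<^sub>F b' in nhds b. b' \<noteq> 0"
    using assms by (rule t1_space_nhds)
  then have "partial_deriv \<mu> (partial_deriv \<nu> energy) b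
      = partial_deriv \<mu> (\<lambda>b'. 2 * (\<Sum>\<beta>\<in>UNIV. G \<nu> \<beta> b' * b' $ \<beta>)) b"
    by (intro partial_deriv_cong_ev) (auto elim!: eventually_mono simp: partial_deriv_energy)
  also have "\<dots> = 2 * G \<mu> \<nu> b"
  proof (rule partial_deriv_eqI)
    note D = has_partial_deriv[OF differentiable[OF assms], of _ _ \<mu>]
    let ?D = "2 * (\<Sum>\<beta>\<in>UNIV. partial_deriv \<mu> (G \<nu> \<beta>) b * b $ \<beta> + G \<nu> \<beta> b * axis \<mu> 1 $ \<beta>)"
    have "((\<lambda>t. 2 * (\<Sum>\<beta>\<in>UNIV. G \<nu> \<beta> (b + t *\<^sub>R axis \<mu> 1) * (b + t *\<^sub>R axis \<mu> 1) $ \<beta>))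
        has_real_derivative ?D) (at 0)"
      unfolding vector_add_component vector_scaleR_component
      by (rule derivative_eq_intros D refl | simp add: algebra_simps)+
    moreover have "G \<nu> = (\<lambda>\<beta>. G \<beta> \<nu>)"
      using commute by blast
    then have "(\<Sum>\<beta>\<in>UNIV. partial_deriv \<mu> (G \<nu> \<beta>) b * b $ \<beta>) = 0"
      using contraction_vanishes[OF assms, of \<mu> \<nu>] by metis
    moreover have "(\<Sum>\<beta>\<in>UNIV. G \<nu> \<beta> b * axis \<mu> 1 $ \<beta>) = G \<mu> \<nu> b"
      by (simp add: axis_def if_distrib sum.delta commute[of _ \<nu>] cong: if_cong)
    ultimately show "((\<lambda>t. 2 * (\<Sum>\<beta>\<in>UNIV. G \<nu> \<beta> (b + t *\<^sub>R axis \<mu> 1) * (b + t *\<^sub>R axis \<mu> 1) $ \<beta>))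
        has_real_derivative 2 * G \<mu> \<nu> b) (at 0)"
      by (simp add: sum.distrib)
  qed
  finally show ?thesis by simp
qed

end

section \<open>Differentiability of the inverse matrix\<close>

lemma differentiable_det:
  fixes B :: "'a::real_normed_vector \<Rightarrow> real ^ 'n ^ 'n::finite"
  assumes "\<And>i j. (\<lambda>x. B x $ i $ j) differentiable (at x)"
  shows "(\<lambda>x. det (B x)) differentiable (at x)"
proof -
  have "(\<lambda>x. \<Prod>i\<in>UNIV. B x $ i $ p i) differentiable (at x)" for p :: "'n \<Rightarrow> 'n"
    unfolding differentiable_def
    by (rule exI, rule has_derivative_prod) (rule assms[unfolded frechet_derivative_works])
  then show ?thesis
    unfolding det_def
    by (intro differentiable_sum differentiable_mult differentiable_const finite_permutations) auto
qed

text \<open>Cramer's rule for the columns of the inverse. It reduces differentiability of the inverse to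
  that of determinants, which are polynomials in the entries.\<close>

lemma matrix_inv_component:
  fixes B :: "real ^ 'n ^ 'n::finite"
  assumes "det B \<noteq> 0"
  shows "matrix_inv B $ k $ l = det (\<chi> i j. if j = k then axis l 1 $ i else B $ i $ j) / det B"
proof -
  have "invertible B"
    using assms by (simp add: invertible_det_nz)
  then have inv: "B ** matrix_inv B = mat 1"
    unfolding invertible_def matrix_inv_def by (rule someI2_ex) simp
  have "B *v (matrix_inv B *v axis l 1) = axis l 1"
    by (simp add: matrix_vector_mul_assoc inv)
  then have "matrix_inv B *v axis l 1
      = (\<chi> k. det (\<chi> i j. if j = k then axis l 1 $ i else B $ i $ j) / det B)"
    using cramer[OF assms] by blast
  moreover have "(matrix_inv B *v axis l 1) $ k = matrix_inv B $ k $ l"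
    by (simp add: matrix_vector_mult_basis column_def)
  ultimately show ?thesis by simp
qed

lemma differentiable_matrix_inv_component:
  fixes B :: "'a::real_normed_vector \<Rightarrow> real ^ 'n ^ 'n::finite"
  assumes diff: "\<And>i j. (\<lambda>x. B x $ i $ j) differentiable (at x)"
    and nz: "\<And>x. x \<in> S \<Longrightarrow> det (B x) \<noteq> 0" and S: "open S" "x \<in> S"
  shows "(\<lambda>x. matrix_inv (B x) $ k $ l) differentiable (at x)"
proof -
  have "(\<lambda>x. (\<chi> i j. if j = k then axis l 1 $ i else B x $ i $ j) $ i $ j) differentiable (at x)" for i j
    using diff[of i j] by (cases "j = k") simp_all
  then have "(\<lambda>x. det (\<chi> i j. if j = k then axis l 1 $ i else B x $ i $ j) / det (B x))
      differentiable (at x)"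
    by (intro differentiable_divide differentiable_det diff nz S)
  then obtain D where "((\<lambda>x. det (\<chi> i j. if j = k then axis l 1 $ i else B x $ i $ j) / det (B x))
      has_derivative D) (at x)"
    unfolding differentiable_def by blast
  then have "((\<lambda>x. matrix_inv (B x) $ k $ l) has_derivative D) (at x)"
    by (rule has_derivative_transform_within_open[OF _ S]) (simp add: matrix_inv_component nz)
  then show ?thesis
    unfolding differentiable_def by blast
qed

section \<open>Coordinates on a tangent space\<close>

lemma smooth_on_differentiable:
  assumes "smooth_on S f" "x \<in> S"
  shows "f differentiable (at x)"
  using assms unfolding smooth_on_def by (metis Ck_on.simps(2))

context smooth_manifold
begin

lemma chart_inj_on:
  assumes "c \<in> A"
  shows "inj_on (snd c) (fst c)"
proof -
  have "openin M (fst c)" and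
    "homeomorphic_map (subtopology M (fst c)) (top_of_set (snd c ` fst c)) (snd c)"
    using charts[OF assms] by (auto simp: is_chart_def)
  then show ?thesis
    using homeomorphic_imp_injective_map topspace_subtopology_subset[OF openin_subset] by metis
qed

lemma chart_inverse:
  assumes "c \<in> A" "x \<in> fst c"
  shows "inv_into (fst c) (snd c) (snd c x) = x"
  using chart_inj_on[OF assms(1)] assms(2) by simp

lemma open_chart_image:
  assumes c: "c \<in> A" and V: "openin M V" "V \<subseteq> fst c"
  shows "open (snd c ` V)"
proof -
  have *: "openin M (fst c)" "open (snd c ` fst c)"
    "homeomorphic_map (subtopology M (fst c)) (top_of_set (snd c ` fst c)) (snd c)"
    using charts[OF c] by (auto simp: is_chart_def)
  have "openin (subtopology M (fst c)) V"
    using V * by (simp add: openin_open_subtopology)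
  then have "openin (top_of_set (snd c ` fst c)) (snd c ` V)"
    using homeomorphic_imp_open_map[OF *(3)] by (simp add: open_map_def)
  then show ?thesis
    using *(2) openin_open_trans by blast
qed

lemma transition_apply:
  assumes "c \<in> A" "x \<in> fst c"
  shows "transition c d (snd c x) = snd d x"
  using assms by (simp add: transition_def chart_inverse)

lemma transition_has_derivative:
  assumes "c \<in> A" "d \<in> A" "x \<in> fst c" "x \<in> fst d"
  shows "(transition c d has_derivative frechet_derivative (transition c d) (at (snd c x))) (at (snd c x))"
  unfolding frechet_derivative_works[symmetric]
  using compatible[OF assms(1,2)] assms(3,4) unfolding smooth_compatible_def
  by (blast intro: smooth_on_differentiable)

lemma linear_transition_derivative:
  assumes "c \<in> A" "d \<in> A" "x \<in> fst c" "x \<in> fst d"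
  shows "linear (frechet_derivative (transition c d) (at (snd c x)))"
  using transition_has_derivative[OF assms] by (rule has_derivative_linear)

lemma transition_derivative_self:
  assumes "c \<in> A" "x \<in> fst c"
  shows "frechet_derivative (transition c c) (at (snd c x)) = (\<lambda>v. v)"
proof -
  have open_dom: "open (snd c ` fst c)"
    using charts[OF assms(1)] by (simp add: is_chart_def)
  have "(transition c c has_derivative (\<lambda>v. v)) (at (snd c x))"
    by (rule has_derivative_transform_within_open[OF has_derivative_ident open_dom])
      (use assms in \<open>auto simp: transition_apply\<close>)
  then show ?thesis
    using frechet_derivative_at by force
qed

text \<open>The cocycle property of the Jacobians: the chain rule for
  \<open>transition c e = transition d e \<circ> transition c d\<close>, an identity that holds on the image of the
  common domain of the three charts.\<close>

lemma transition_derivative_compose: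
  assumes A: "c \<in> A" "d \<in> A" "e \<in> A" and x: "x \<in> fst c" "x \<in> fst d" "x \<in> fst e"
  shows "frechet_derivative (transition d e) (at (snd d x))
      (frechet_derivative (transition c d) (at (snd c x)) v)
    = frechet_derivative (transition c e) (at (snd c x)) v"
proof -
  let ?V = "fst c \<inter> fst d \<inter> fst e"
  have V: "openin M ?V"
    using A charts by (simp add: is_chart_def openin_Int)
  have open_dom: "open (snd c ` ?V)"
    by (rule open_chart_image[OF A(1) V]) blast
  have "((\<lambda>z. transition d e (transition c d z)) has_derivative
      (\<lambda>v. frechet_derivative (transition d e) (at (snd d x))
        (frechet_derivative (transition c d) (at (snd c x)) v))) (at (snd c x))"
    by (rule has_derivative_compose)
      (use A x in \<open>simp_all add: transition_has_derivative transition_apply\<close>)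
  then have "(transition c e has_derivative
      (\<lambda>v. frechet_derivative (transition d e) (at (snd d x))
        (frechet_derivative (transition c d) (at (snd c x)) v))) (at (snd c x))"
    by (rule has_derivative_transform_within_open[OF _ open_dom])
      (use A x in \<open>auto simp: transition_apply\<close>)
  then show ?thesis
    using frechet_derivative_at by metis
qed

text \<open>The cocycle property makes a component vector in one chart a tangent vector. With
  \<open>tvec_of_component\<close> and \<open>tvec_of_tangent_vector\<close> below, \<open>tvec_of A c x\<close> is a bijection from
  coordinate space onto the tangent space at \<open>x\<close>, whose inverse reads off the component in \<open>c\<close>.\<close>

lemma tvec_of_in_tangent_space:
  assumes "c \<in> A" "x \<in> fst c"
  shows "tvec_of A c x b \<in> tangent_space A x"
proof -
  have "tvec_of A c x b e
      = frechet_derivative (transition d e) (at (snd d x)) (tvec_of A c x b d)"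
    if "d \<in> A" "e \<in> A" "x \<in> fst d \<inter> fst e" for d e
    using assms that by (simp add: tvec_of_def transition_derivative_compose)
  moreover have "tvec_of A c x b e = 0" if "\<not> (e \<in> A \<and> x \<in> fst e)" for e
    using that by (auto simp: tvec_of_def)
  ultimately show ?thesis
    unfolding tangent_space_def by blast
qed

lemma tvec_of_component:
  assumes "c \<in> A" "x \<in> fst c"
  shows "tvec_of A c x b c = b"
  using assms by (simp add: tvec_of_def transition_derivative_self)

lemma tangent_vector_component:
  assumes "y \<in> tangent_space A x" "c \<in> A" "x \<in> fst c"
  shows "y d = (if d \<in> A \<and> x \<in> fst d then frechet_derivative (transition c d) (at (snd c x)) (y c) else 0)"
proof (cases "d \<in> A \<and> x \<in> fst d")
  case True
  then have "y d = frechet_derivative (transition c d) (at (snd c x)) (y c)"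
    using assms unfolding tangent_space_def by blast
  with True show ?thesis by simp
next
  case False
  then have "y d = 0"
    using assms(1) unfolding tangent_space_def by blast
  with False show ?thesis by auto
qed

lemma tvec_of_tangent_vector:
  assumes "y \<in> tangent_space A x" "c \<in> A" "x \<in> fst c"
  shows "tvec_of A c x (y c) = y"
proof
  show "tvec_of A c x (y c) d = y d" for d
    unfolding tvec_of_def tangent_vector_component[OF assms, of d] ..
qed

lemma tscale_tvec_of:
  assumes "c \<in> A" "x \<in> fst c"
  shows "tscale s (tvec_of A c x b) = tvec_of A c x (s *\<^sub>R b)"
  using assms by (auto simp: tscale_def tvec_of_def linear_scale[OF linear_transition_derivative])

lemma tpoint_of_chart_point:
  assumes "c \<in> A" "x \<in> fst c"
  shows "tpoint_of A c (snd c x, b) = (x, tvec_of A c x b)"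
  using assms by (simp add: tpoint_of_def chart_inverse Let_def)

lemma chart_domain_subset:
  assumes "c \<in> A"
  shows "fst c \<subseteq> topspace M"
  using assms cover by blast

lemma tvec_of_in_tangent_bundle:
  assumes "c \<in> A" "x \<in> fst c"
  shows "(x, tvec_of A c x b) \<in> tangent_bundle M A"
  using chart_domain_subset[OF assms(1)] assms(2) tvec_of_in_tangent_space[OF assms]
  by (auto simp: tangent_bundle_def)

lemma tvec_of_in_slit_bundle:
  assumes "c \<in> A" "x \<in> fst c" "b \<noteq> 0"
  shows "(x, tvec_of A c x b) \<in> slit_bundle M A"
proof -
  have "tvec_of A c x b \<noteq> tzero"
    using tvec_of_component[OF assms(1,2), of b] assms(3) by (auto simp: tzero_def)
  then show ?thesis
    using tvec_of_in_tangent_bundle[OF assms(1,2)] by (simp add: slit_bundle_def)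
qed

text \<open>The bridge between the bundle and coordinate space. As it holds for all \<open>b\<close>, it also converts
  iterated vertical derivatives.\<close>

lemma vpartial_tvec_of:
  assumes "c \<in> A" "x \<in> fst c"
  shows "vpartial A c \<mu> f (x, tvec_of A c x b) = partial_deriv \<mu> (\<lambda>b. f (x, tvec_of A c x b)) b"
  using assms by (simp add: vpartial_def partial_deriv_def tpoint_of_chart_point tvec_of_component)

text \<open>Linear relations between tangent vectors are visible in a single chart, because the
  components in any other chart are obtained by a linear map.\<close>

lemma tsum_eq_tzero_if_component:
  assumes v: "\<And>i. v i \<in> tangent_space A x" and c: "c \<in> A" "x \<in> fst c"
    and zero: "(\<Sum>i\<in>UNIV. a i *\<^sub>R v i c) = 0"
  shows "tsum (\<lambda>i. tscale (a i) (v i)) = tzero"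
proof
  fix d
  have v_d: "v i d = (if d \<in> A \<and> x \<in> fst d
      then frechet_derivative (transition c d) (at (snd c x)) (v i c) else 0)" for i
    using v c by (rule tangent_vector_component)
  show "tsum (\<lambda>i. tscale (a i) (v i)) d = tzero d"
  proof (cases "d \<in> A \<and> x \<in> fst d")
    case True
    then have lin: "linear (frechet_derivative (transition c d) (at (snd c x)))"
      using c by (simp add: linear_transition_derivative)
    have "tsum (\<lambda>i. tscale (a i) (v i)) d
        = frechet_derivative (transition c d) (at (snd c x)) (\<Sum>i\<in>UNIV. a i *\<^sub>R v i c)"
      using True by (simp add: tsum_def tscale_def v_d linear_sum[OF lin] linear_scale[OF lin])
    then show ?thesis
      by (simp add: zero linear_0[OF lin] tzero_def)
  next
    case False
    then have "v i d = 0" for i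
      using v_d[of i] by auto
    then show ?thesis
      by (simp add: tsum_def tscale_def tzero_def)
  qed
qed

end

section \<open>The GAP-metric in fibre coordinates\<close>

context fp_space
begin

lemma det_frame_matrix_nonzero:
  assumes c: "c \<in> A" "x \<in> fst c" and p: "(x, y) \<in> tangent_bundle M A"
  shows "det (frame_matrix lam c (x, y)) \<noteq> 0"
proof -
  have v: "lam i (x, y) \<in> tangent_space A x" for i
    using sections[of i] p by (auto simp: pullback_section_def)
  have "a i = 0" if "(\<Sum>i\<in>UNIV. a i *s row i (frame_matrix lam c (x, y))) = 0" for a i
  proof -
    have "(\<Sum>i\<in>UNIV. a i *\<^sub>R lam i (x, y) c) = 0"
      using that by (simp add: row_def frame_matrix_def vec_lambda_eta scalar_mult_eq_scaleR)
    from tsum_eq_tzero_if_component[OF v c this] show ?thesis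
      using independent[OF p] by blast
  qed
  then have "invertible (frame_matrix lam c (x, y))"
    using matrix_right_invertible_independent_rows invertible_right_inverse by blast
  then show ?thesis
    by (simp add: invertible_det_nz)
qed

text \<open>Smoothness of the sections in the coordinates \<open>(x, y)\<close> is restricted to the slice of fixed
  \<open>x\<close>.\<close>

lemma differentiable_frame_matrix:
  assumes c: "c \<in> A" "x \<in> fst c" and b: "b \<noteq> 0"
  shows "(\<lambda>b. frame_matrix lam c (x, tvec_of A c x b) $ i $ j) differentiable (at b)"
proof -
  have "(\<lambda>q. lam i (tpoint_of A c q) c) differentiable (at (snd c x, b))"
    using smooth[of i] c b
    by (auto simp: smooth_section_on_slit_def intro: smooth_on_differentiable)
  then have outer: "(\<lambda>q. lam i (tpoint_of A c q) c $ j) differentiable (at (snd c x, b))"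
    by (auto simp: differentiable_def intro: bounded_linear.has_derivative[OF bounded_linear_vec_nth])
  have "(\<lambda>b. (snd c x, b)) differentiable (at b)"
    unfolding differentiable_def by (rule exI) (rule has_derivative_Pair derivative_intros)+
  from differentiable_compose[OF outer this] show ?thesis
    by (simp add: frame_matrix_def tpoint_of_chart_point[OF c])
qed

lemma differentiable_gap_metric:
  assumes c: "c \<in> A" "x \<in> fst c" and b: "b \<noteq> 0"
  shows "(\<lambda>b. gap_metric lam c \<mu> \<nu> (x, tvec_of A c x b)) differentiable (at b)"
  unfolding gap_metric_def coframe_def
  by (intro differentiable_sum differentiable_mult ballI
      differentiable_matrix_inv_component[where S=UNIV])
    (use c b in \<open>auto simp: differentiable_frame_matrix det_frame_matrix_nonzero
      tvec_of_in_tangent_bundle\<close>)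

lemma gap_metric_commute:
  "gap_metric lam c \<mu> \<nu> p = gap_metric lam c \<nu> \<mu> p"
  by (simp add: gap_metric_def mult.commute)

lemma gap_metric_homogeneous:
  assumes "c \<in> A" "x \<in> fst c" "0 < s"
  shows "gap_metric lam c \<mu> \<nu> (x, tvec_of A c x (s *\<^sub>R b)) = gap_metric lam c \<mu> \<nu> (x, tvec_of A c x b)"
  using assms by (simp add: gap_metric_def coframe_def frame_matrix_def homogeneous
      tvec_of_in_tangent_bundle flip: tscale_tvec_of)

text \<open>The quadratic form of the GAP-metric is \<open>\<Sum>\<^sub>i (\<lambda>\<^sub>i\<^sub>\<mu> b\<^sup>\<mu>)\<^sup>2\<close>. So the square root that defines \<open>F\<close>
  is taken of a non-negative number, and \<open>F\<^sup>2\<close> is the quadratic form itself.\<close>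

lemma gap_metric_nonneg:
  "0 \<le> (\<Sum>\<mu>\<in>UNIV. \<Sum>\<nu>\<in>UNIV. gap_metric lam c \<mu> \<nu> p * b $ \<mu> * b $ \<nu>)"
proof -
  have "(\<Sum>\<mu>\<in>UNIV. \<Sum>\<nu>\<in>UNIV. gap_metric lam c \<mu> \<nu> p * b $ \<mu> * b $ \<nu>)
      = (\<Sum>\<mu>\<in>UNIV. \<Sum>\<nu>\<in>UNIV. \<Sum>i\<in>UNIV. (coframe lam c i \<mu> p * b $ \<mu>) * (coframe lam c i \<nu> p * b $ \<nu>))"
    by (simp add: gap_metric_def sum_distrib_left sum_distrib_right mult_ac)
  also have "\<dots> = (\<Sum>\<mu>\<in>UNIV. \<Sum>i\<in>UNIV. \<Sum>\<nu>\<in>UNIV. (coframe lam c i \<mu> p * b $ \<mu>) * (coframe lam c i \<nu> p * b $ \<nu>))"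
    by (intro sum.cong refl sum.swap)
  also have "\<dots> = (\<Sum>i\<in>UNIV. \<Sum>\<mu>\<in>UNIV. \<Sum>\<nu>\<in>UNIV. (coframe lam c i \<mu> p * b $ \<mu>) * (coframe lam c i \<nu> p * b $ \<nu>))"
    by (rule sum.swap)
  also have "\<dots> = (\<Sum>i\<in>UNIV. (\<Sum>\<mu>\<in>UNIV. coframe lam c i \<mu> p * b $ \<mu>)\<^sup>2)"
    by (simp add: power2_eq_square sum_product)
  also have "\<dots> \<ge> 0"
    by (simp add: sum_nonneg)
  finally show ?thesis .
qed

lemma cartan_symmetric_gap_metric:
  assumes "c \<in> A" "x \<in> fst c"
  shows "cartan_symmetric (\<lambda>\<mu> \<nu> b. gap_metric lam c \<mu> \<nu> (x, tvec_of A c x b))"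
proof
  show "partial_deriv \<alpha> (\<lambda>b. gap_metric lam c \<mu> \<nu> (x, tvec_of A c x b)) b
      = partial_deriv \<mu> (\<lambda>b. gap_metric lam c \<alpha> \<nu> (x, tvec_of A c x b)) b" if "b \<noteq> 0" for \<alpha> \<mu> \<nu> b
    using symmetric[OF assms tvec_of_in_slit_bundle[OF assms that]]
    by (simp add: vpartial_tvec_of[OF assms])
qed (use assms in \<open>simp_all add: differentiable_gap_metric gap_metric_homogeneous gap_metric_commute\<close>)

lemma F_power2:
  assumes "c \<in> A" "x \<in> fst c" "b \<noteq> 0"
  shows "(F (x, tvec_of A c x b))\<^sup>2
    = (\<Sum>\<mu>\<in>UNIV. \<Sum>\<nu>\<in>UNIV. gap_metric lam c \<mu> \<nu> (x, tvec_of A c x b) * b $ \<mu> * b $ \<nu>)"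
  using F_slit[OF assms(1,2) tvec_of_in_slit_bundle[OF assms]] gap_metric_nonneg
  by (simp add: tvec_of_component[OF assms(1,2)])

lemma gap_metric_eq_finsler_metric:
  assumes c: "c \<in> A" "x \<in> fst c" and p: "(x, y) \<in> slit_bundle M A"
  shows "gap_metric lam c \<mu> \<nu> (x, y) = finsler_metric A F c \<mu> \<nu> (x, y)"
proof -
  interpret G: cartan_symmetric "\<lambda>\<mu> \<nu> b. gap_metric lam c \<mu> \<nu> (x, tvec_of A c x b)"
    using c by (rule cartan_symmetric_gap_metric)
  have y: "y \<in> tangent_space A x" "y \<noteq> tzero"
    using p by (auto simp: slit_bundle_def tangent_bundle_def)
  have y_eq: "tvec_of A c x (y c) = y"
    by (rule tvec_of_tangent_vector[OF y(1) c])
  have "tvec_of A c x 0 = tzero"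
    using c by (auto simp: tvec_of_def tzero_def linear_0[OF linear_transition_derivative])
  then have nz: "y c \<noteq> 0"
    using y(2) y_eq by auto
  \<comment> \<open>\<open>F\<^sup>2\<close> and the energy agree near each nonzero vector, so both derivatives can be exchanged.\<close>
  have inner: "partial_deriv \<nu> (\<lambda>b. (F (x, tvec_of A c x b))\<^sup>2) b = partial_deriv \<nu> G.energy b"
    if "b \<noteq> 0" for b
    using t1_space_nhds[OF that]
    by (intro partial_deriv_cong_ev) (auto elim!: eventually_mono simp: F_power2[OF c] G.energy_def)
  have "finsler_metric A F c \<mu> \<nu> (x, tvec_of A c x (y c))
      = partial_deriv \<mu> (partial_deriv \<nu> (\<lambda>b. (F (x, tvec_of A c x b))\<^sup>2)) (y c) / 2"
    by (simp add: finsler_metric_def vpartial_tvec_of[OF c])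
  also have "\<dots> = partial_deriv \<mu> (partial_deriv \<nu> G.energy) (y c) / 2"
    using partial_deriv_cong_ev[OF eventually_mono[OF t1_space_nhds[OF nz] inner]] by simp
  also have "\<dots> = gap_metric lam c \<mu> \<nu> (x, tvec_of A c x (y c))"
    by (rule G.half_hessian_energy[OF nz])
  finally show ?thesis
    by (simp add: y_eq)
qed

end

theorem theorem3p2:
  fixes M :: "'m topology"
    and A :: "('m, 'n::finite) chart set"
    and lam :: "'n \<Rightarrow> ('m, 'n) tpoint \<Rightarrow> ('m, 'n) tvec"
    and F :: "('m, 'n) tpoint \<Rightarrow> real"
    and c :: "('m, 'n) chart"
    and x :: 'm
    and y :: "('m, 'n) tvec"
    and \<mu> \<nu> :: 'n
  assumes "fp_space M A lam F"
    and "c \<in> A" and "x \<in> fst c" and "(x, y) \<in> slit_bundle M A"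
  shows "gap_metric lam c \<mu> \<nu> (x, y) =
      (\<Sum>i\<in>UNIV. coframe lam c i \<mu> (x, y) * coframe lam c i \<nu> (x, y)) \<and>
    gap_metric lam c \<mu> \<nu> (x, y) = finsler_metric A F c \<mu> \<nu> (x, y)"
  using gap_metric_def fp_space.gap_metric_eq_finsler_metric[OF assms] by blast

end
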